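(* Let $(S,s)$ be a finite irretractable bijective set-theoretic solution to the Pentagon Equation corresponding to the matched pair of groups $(A,G,\sigma,\delta)$, and let $X$ be a non-empty set. Then $\mathrm{Ext}_X^{\varphi}(S,s)$ is isomorphic to $\mathrm{Ext}_X^{\rho}(S,s)$ for any families of bijections $\varphi=\{\varphi_a\}_{a\in A}$ and $\rho=\{\rho_a\}_{a\in A}$ of $X$.
   Context: A set-theoretic solution to the Pentagon Equation is a pair $(S,s)$ with $S$ a nonempty set and $s:S\times S\to S\times S$ a map such that $s_{23}s_{13}s_{12}=s_{12}s_{23}$ on $S\times S\times S$, where $s_{12}=s\times\mathrm{id}$, $s_{23}=\mathrm{id}\times s$, $s_{13}=(\tau\times\mathrm{id})(\mathrm{id}\times s)(\tau\times\mathrm{id})$ and $\tau(x,y)=(y,x)$. It is finite if $S$ is finite, and bijective if $s$ is bijective. Two solutions $(S,s)$, $(T,t)$ are isomorphic if there is a bijection $f:S\to T$ with $(f\times f)s=t(f\times f)$. Write $s(x,y)=(x\cdot y,\theta_x(y))$ and $s^{-1}(x,y)=(\psi_y(x),y\circ x)$; $(S,\cdot)$ and $(S,\circ)$ are semigroups, which are left groups (isomorphic to $E\times H$ with $H$ a group and $(e,g)(f,h)=(e,gh)$) for finite bijective solutions. $E(S,\cdot)$, $E(S,\circ)$ are the sets of idempotents. Fix $e_0\in E(S,\cdot)$, put $1=\theta_{e_0}(e_0)$, an idempotent of $(S,\cdot)$, and $G_1=1\cdot S$. Every element of $S$ is uniquely $e\cdot g$ with $e\in E(S,\cdot)$, $g\in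 G_1$. Define $e\cdot g\approx f\cdot h$ (for $e,f\in E(S,\cdot)$, $g,h\in G_1$) iff $\theta_e=\theta_f$ and $g=h$. The solution is irretractable if $\approx$ is equality. For a finite irretractable bijective solution, $G=1\cdot S=E(S,\circ)$ is a group under $\cdot$, $A=1\circ S=E(S,\cdot)$ is a group under $\circ$, both with identity $1$, and $S$ is identified with $A\times G$ via $(a,x)=a\cdot x$. Put $\sigma_a(x)=1\cdot\theta_a(x)$ and $\delta_x(a)=(1\circ\psi_{x^{-1}}(a^{-1}))^{-1}$ (inverses in $(G,\cdot)$ and $(A,\circ)$). Then $(A,G,\sigma,\delta)$ is a matched pair of groups, i.e. $\sigma:A\to\mathrm{Sym}(G)$ is a left action, $\delta:G\to\mathrm{Sym}(A)$ is a right action, $\sigma_a(xy)=\sigma_a(x)\sigma_{\delta_x(a)}(y)$ and $\delta_x(ab)=\delta_{\sigma_b(x)}(a)\delta_x(b)$; this is the matched pair corresponding to $(S,s)$, and $s((a,x),(b,y))=((a,xy),(b(\delta_x(a))^{-1},\sigma_{\delta_x(a)}(y)))$, where products and inverses of elements of $A$ are in $(A,\circ)$. $\mathrm{Ext}_X^{\varphi}(S,s)$ is the solution on $X\times S=X\times A\times G$ given by $$((\alpha,a,x),(\beta,b,y))\mapsto\big((\alpha,a,xy),\ (\varphi^{-1}_{b(\delta_x(a))^{-1}}\varphi_b(\beta),\ b(\delta_x(a))^{-1},\ \sigma_{\delta_x(a)}(y))\big).$$ *)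

theory Defs
  imports "HOL-Algebra.Group"
begin

text \<open>A set-theoretic map is given by a carrier set \<open>S\<close> and a function \<open>s\<close> on pairs;
  only its values on \<open>S \<times> S\<close> matter.  Triples are nested to the right,
  so the map \<open>s\<^sub>2\<^sub>3 = id \<times> s\<close> is \<open>map_prod id s\<close>.\<close>

definition pe_12 :: "('a \<times> 'a \<Rightarrow> 'a \<times> 'a) \<Rightarrow> 'a \<times> 'a \<times> 'a \<Rightarrow> 'a \<times> 'a \<times> 'a" where
  "pe_12 s = (\<lambda>(x, y, z). case s (x, y) of (u, v) \<Rightarrow> (u, v, z))"

definition pe_23 :: "('a \<times> 'a \<Rightarrow> 'a \<times> 'a) \<Rightarrow> 'a \<times> 'a \<times> 'a \<Rightarrow> 'a \<times> 'a \<times> 'a" where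
  "pe_23 s = map_prod id s"

definition pe_13 :: "('a \<times> 'a \<Rightarrow> 'a \<times> 'a) \<Rightarrow> 'a \<times> 'a \<times> 'a \<Rightarrow> 'a \<times> 'a \<times> 'a" where
  "pe_13 s = pe_12 prod.swap \<circ> pe_23 s \<circ> pe_12 prod.swap"

definition pe_solution :: "'a set \<Rightarrow> ('a \<times> 'a \<Rightarrow> 'a \<times> 'a) \<Rightarrow> bool" where
  "pe_solution S s \<longleftrightarrow>
     S \<noteq> {} \<and> s ` (S \<times> S) \<subseteq> S \<times> S \<and>
     (\<forall>p \<in> S \<times> S \<times> S. (pe_23 s \<circ> pe_13 s \<circ> pe_12 s) p = (pe_12 s \<circ> pe_23 s) p)"

definition pe_bijective :: "'a set \<Rightarrow> ('a \<times> 'a \<Rightarrow> 'a \<times> 'a) \<Rightarrow> bool" where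
  "pe_bijective S s \<longleftrightarrow> bij_betw s (S \<times> S) (S \<times> S)"

definition pe_isomorphic ::
  "'a set \<Rightarrow> ('a \<times> 'a \<Rightarrow> 'a \<times> 'a) \<Rightarrow> 'b set \<Rightarrow> ('b \<times> 'b \<Rightarrow> 'b \<times> 'b) \<Rightarrow> bool" where
  "pe_isomorphic S s T t \<longleftrightarrow>
     (\<exists>f. bij_betw f S T \<and>
          (\<forall>p \<in> S \<times> S. (map_prod f f \<circ> s) p = (t \<circ> map_prod f f) p))"

text \<open>Components: \<open>s (x, y) = (pe_dot s x y, pe_theta s x y)\<close> and
  \<open>s\<inverse> (x, y) = (pe_psi S s y x, pe_circ S s y x)\<close>.  Note the order of the
  arguments in the components of the inverse.\<close>

definition pe_dot :: "('a \<times> 'a \<Rightarrow> 'a \<times> 'a) \<Rightarrow> 'a \<Rightarrow> 'a \<Rightarrow> 'a" where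
  "pe_dot s x y = fst (s (x, y))"

definition pe_theta :: "('a \<times> 'a \<Rightarrow> 'a \<times> 'a) \<Rightarrow> 'a \<Rightarrow> 'a \<Rightarrow> 'a" where
  "pe_theta s x y = snd (s (x, y))"

definition pe_psi :: "'a set \<Rightarrow> ('a \<times> 'a \<Rightarrow> 'a \<times> 'a) \<Rightarrow> 'a \<Rightarrow> 'a \<Rightarrow> 'a" where
  "pe_psi S s y x = fst (inv_into (S \<times> S) s (x, y))"

definition pe_circ :: "'a set \<Rightarrow> ('a \<times> 'a \<Rightarrow> 'a \<times> 'a) \<Rightarrow> 'a \<Rightarrow> 'a \<Rightarrow> 'a" where
  "pe_circ S s y x = snd (inv_into (S \<times> S) s (x, y))"

definition pe_idempotents :: "'a set \<Rightarrow> ('a \<Rightarrow> 'a \<Rightarrow> 'a) \<Rightarrow> 'a set" where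
  "pe_idempotents S m = {e \<in> S. m e e = e}"

text \<open>In what follows \<open>e0\<close> is a chosen idempotent of \<open>(S, \<cdot>)\<close>.\<close>

definition pe_one :: "('a \<times> 'a \<Rightarrow> 'a \<times> 'a) \<Rightarrow> 'a \<Rightarrow> 'a" where
  "pe_one s e0 = pe_theta s e0 e0"

definition pe_G :: "'a set \<Rightarrow> ('a \<times> 'a \<Rightarrow> 'a \<times> 'a) \<Rightarrow> 'a \<Rightarrow> 'a monoid" where
  "pe_G S s e0 =
     \<lparr>carrier = pe_dot s (pe_one s e0) ` S, mult = pe_dot s, one = pe_one s e0\<rparr>"

definition pe_A :: "'a set \<Rightarrow> ('a \<times> 'a \<Rightarrow> 'a \<times> 'a) \<Rightarrow> 'a \<Rightarrow> 'a monoid" where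
  "pe_A S s e0 =
     \<lparr>carrier = pe_circ S s (pe_one s e0) ` S, mult = pe_circ S s, one = pe_one s e0\<rparr>"

text \<open>The relation \<open>\<approx>\<close>; equality \<open>\<theta>\<^sub>e = \<theta>\<^sub>f\<close> is equality of maps on \<open>S\<close>.\<close>

definition pe_retract_rel :: "'a set \<Rightarrow> ('a \<times> 'a \<Rightarrow> 'a \<times> 'a) \<Rightarrow> 'a \<Rightarrow> ('a \<times> 'a) set" where
  "pe_retract_rel S s e0 =
     {(pe_dot s e g, pe_dot s f h) | e f g h.
        e \<in> pe_idempotents S (pe_dot s) \<and> f \<in> pe_idempotents S (pe_dot s) \<and>
        g \<in> carrier (pe_G S s e0) \<and> h \<in> carrier (pe_G S s e0) \<and>
        (\<forall>z \<in> S. pe_theta s e z = pe_theta s f z) \<and> g = h}"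

definition pe_irretractable :: "'a set \<Rightarrow> ('a \<times> 'a \<Rightarrow> 'a \<times> 'a) \<Rightarrow> 'a \<Rightarrow> bool" where
  "pe_irretractable S s e0 \<longleftrightarrow> pe_retract_rel S s e0 = Id_on S"

definition pe_sigma :: "('a \<times> 'a \<Rightarrow> 'a \<times> 'a) \<Rightarrow> 'a \<Rightarrow> 'a \<Rightarrow> 'a \<Rightarrow> 'a" where
  "pe_sigma s e0 a x = pe_dot s (pe_one s e0) (pe_theta s a x)"

definition pe_delta :: "'a set \<Rightarrow> ('a \<times> 'a \<Rightarrow> 'a \<times> 'a) \<Rightarrow> 'a \<Rightarrow> 'a \<Rightarrow> 'a \<Rightarrow> 'a" where
  "pe_delta S s e0 x a =
     inv\<^bsub>pe_A S s e0\<^esub>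
       (pe_circ S s (pe_one s e0)
         (pe_psi S s (inv\<^bsub>pe_G S s e0\<^esub> x) (inv\<^bsub>pe_A S s e0\<^esub> a)))"

text \<open>The underlying set and the map of the extension \<open>Ext\<^sub>X\<^sup>\<phi>\<close> attached to data
  \<open>(A, G, \<sigma>, \<delta>)\<close>; \<open>\<delta> x a\<close> stands for \<open>\<delta>\<^sub>x(a)\<close>.\<close>

definition pe_ext_carrier ::
  "'x set \<Rightarrow> 'a monoid \<Rightarrow> 'g monoid \<Rightarrow> ('x \<times> 'a \<times> 'g) set" where
  "pe_ext_carrier X A G = X \<times> carrier A \<times> carrier G"

definition pe_ext ::
  "'x set \<Rightarrow> ('a \<Rightarrow> 'x \<Rightarrow> 'x) \<Rightarrow> 'a monoid \<Rightarrow> 'g monoid \<Rightarrow> ('a \<Rightarrow> 'g \<Rightarrow> 'g) \<Rightarrow> ('g \<Rightarrow> 'a \<Rightarrow> 'a) \<Rightarrow>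
   ('x \<times> 'a \<times> 'g) \<times> ('x \<times> 'a \<times> 'g) \<Rightarrow> ('x \<times> 'a \<times> 'g) \<times> ('x \<times> 'a \<times> 'g)" where
  "pe_ext X \<phi> A G \<sigma> \<delta> =
     (\<lambda>((\<alpha>, a, x), (\<beta>, b, y)).
        let c = b \<otimes>\<^bsub>A\<^esub> inv\<^bsub>A\<^esub> (\<delta> x a)
        in ((\<alpha>, a, x \<otimes>\<^bsub>G\<^esub> y), (inv_into X (\<phi> c) (\<phi> b \<beta>), c, \<sigma> (\<delta> x a) y)))"

end

theory Submission
  imports Defs
begin

text \<open>The isomorphism is \<open>(\<alpha>, a, x) \<mapsto> (\<rho>\<^sub>a\<inverse> \<phi>\<^sub>a \<alpha>, a, x)\<close>; it intertwines the two extensions as soon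
  as \<open>b (\<delta>\<^sub>x(a))\<inverse>\<close> lies in \<open>A\<close>, so what has to be shown is that \<open>(A, \<circ>)\<close> and \<open>(G, \<cdot>)\<close> are groups.

  Since \<open>s\<close> is a permutation of a finite set, counting shows that \<open>xy\<close> in a right (left) ideal of
  \<open>(S, \<cdot>)\<close> forces \<open>x\<close> (\<open>y\<close>) to lie in it.  The maps \<open>\<theta>\<^sub>x\<close> form an action of \<open>(S, \<circ>)\<close>.  If \<open>p\<close> is an
  idempotent of \<open>(S, \<circ>)\<close>, the image of \<open>\<theta>\<^sub>p\<close> is a right ideal of \<open>(S, \<cdot>)\<close>; for \<open>w\<close> in it one gets
  \<open>wy = \<theta>\<^sub>p(wy) = w \<theta>\<^sub>q(y)\<close> with \<open>q = p w\<close>, whence \<open>\<theta>\<^sub>q\<close> is injective, and then so is every \<open>\<theta>\<^sub>x\<close>.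
  Hence \<open>\<theta>\<^sub>p\<close> is the identity, \<open>s(p, y) = (p y, y)\<close>, and \<open>p \<mapsto> p y\<close> permutes the idempotents of
  \<open>(S, \<circ>)\<close>, which makes each of them a right identity of \<open>(S, \<circ>)\<close>.  The passage from \<open>s\<close> to
  \<open>\<tau> s\<inverse> \<tau>\<close> exchanges the two operations.\<close>

text \<open>\<open>m\<close>, \<open>th\<close>, \<open>c\<close>, \<open>ps\<close> stand for \<open>x \<cdot> y\<close>, \<open>\<theta>\<^sub>x(y)\<close>, \<open>x \<circ> y\<close>, \<open>\<psi>\<^sub>x(y)\<close>.  The axioms are
  redundant so that they are visibly invariant under swapping \<open>(m, th)\<close> with \<open>(c, ps)\<close>.\<close>

locale finite_bijective_pentagon =
  fixes S :: "'a set" and m th c ps :: "'a \<Rightarrow> 'a \<Rightarrow> 'a"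
  assumes fin: "finite S"
    and m_closed [simp]: "x \<in> S \<Longrightarrow> y \<in> S \<Longrightarrow> m x y \<in> S"
    and th_closed [simp]: "x \<in> S \<Longrightarrow> y \<in> S \<Longrightarrow> th x y \<in> S"
    and c_closed [simp]: "x \<in> S \<Longrightarrow> y \<in> S \<Longrightarrow> c x y \<in> S"
    and ps_closed [simp]: "x \<in> S \<Longrightarrow> y \<in> S \<Longrightarrow> ps x y \<in> S"
    and m_assoc: "x \<in> S \<Longrightarrow> y \<in> S \<Longrightarrow> z \<in> S \<Longrightarrow> m (m x y) z = m x (m y z)"
    and c_assoc: "x \<in> S \<Longrightarrow> y \<in> S \<Longrightarrow> z \<in> S \<Longrightarrow> c (c x y) z = c x (c y z)"
    and th_m: "x \<in> S \<Longrightarrow> y \<in> S \<Longrightarrow> z \<in> S \<Longrightarrow> th x (m y z) = m (th x y) (th (m x y) z)"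
    and ps_c: "x \<in> S \<Longrightarrow> y \<in> S \<Longrightarrow> z \<in> S \<Longrightarrow> ps x (c y z) = c (ps x y) (ps (c x y) z)"
    and th_action: "x \<in> S \<Longrightarrow> y \<in> S \<Longrightarrow> z \<in> S \<Longrightarrow> th (c x y) z = th x (th y z)"
    and ps_action: "x \<in> S \<Longrightarrow> y \<in> S \<Longrightarrow> z \<in> S \<Longrightarrow> ps (m x y) z = ps x (ps y z)"
    and m_ps_c: "x \<in> S \<Longrightarrow> y \<in> S \<Longrightarrow> m (ps y x) (c y x) = x"
    and th_ps_c: "x \<in> S \<Longrightarrow> y \<in> S \<Longrightarrow> th (ps y x) (c y x) = y"
    and c_th_m: "x \<in> S \<Longrightarrow> y \<in> S \<Longrightarrow> c (th x y) (m x y) = y"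
    and ps_th_m: "x \<in> S \<Longrightarrow> y \<in> S \<Longrightarrow> ps (th x y) (m x y) = x"
begin

lemma dual: "finite_bijective_pentagon S c ps m th"
  by unfold_locales (simp_all add: fin m_assoc c_assoc th_m ps_c th_action ps_action
    m_ps_c th_ps_c c_th_m ps_th_m)

section \<open>Minimality of one-sided ideals, and idempotents\<close>

lemma inj_on_pentagon: "inj_on (\<lambda>(x, y). (m x y, th x y)) (S \<times> S)"
proof (rule inj_onI, clarify)
  fix x y x' y'
  assume "x \<in> S" "y \<in> S" "x' \<in> S" "y' \<in> S" "m x y = m x' y'" "th x y = th x' y'"
  then show "x = x' \<and> y = y'"
    using c_th_m ps_th_m by metis
qed

lemma right_ideal_factor:
  assumes R: "R \<subseteq> S" "\<And>x y. x \<in> R \<Longrightarrow> y \<in> S \<Longrightarrow> m x y \<in> R"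
    and xy: "x \<in> S" "y \<in> S" "m x y \<in> R"
  shows "x \<in> R"
proof -
  let ?h = "\<lambda>(x, y). (m x y, th x y)"
  have inj: "inj_on ?h (R \<times> S)"
    using inj_on_pentagon by (rule inj_on_subset) (use R in auto)
  have sub: "?h ` (R \<times> S) \<subseteq> R \<times> S"
    using R by auto
  have "finite (R \<times> S)"
    using R fin by (auto intro: finite_subset)
  then have "?h ` (R \<times> S) = R \<times> S"
    using inj sub by (simp add: endo_inj_surj)
  \<comment> \<open>Membership of the image in \<open>R \<times> S\<close> depends only on the
    product, so some pair of \<open>R \<times> S\<close> has the same image as
    \<open>(x, y)\<close>.\<close>
  moreover have "?h (x, y) \<in> R \<times> S"
    using xy by simp
  ultimately obtain z where "z \<in> R \<times> S" "?h z = ?h (x, y)"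
    by (metis (no_types, lifting) imageE)
  then have "z = (x, y)"
    using inj_onD[OF inj_on_pentagon, of z "(x, y)"] R xy by auto
  then show ?thesis
    using \<open>z \<in> R \<times> S\<close> by simp
qed

lemma left_ideal_factor:
  assumes L: "L \<subseteq> S" "\<And>x y. x \<in> S \<Longrightarrow> y \<in> L \<Longrightarrow> m x y \<in> L"
    and xy: "x \<in> S" "y \<in> S" "m x y \<in> L"
  shows "y \<in> L"
proof -
  let ?h = "\<lambda>(x, y). (m x y, th x y)"
  have inj: "inj_on ?h (S \<times> L)"
    using inj_on_pentagon by (rule inj_on_subset) (use L in auto)
  have sub: "?h ` (S \<times> L) \<subseteq> L \<times> S"
    using L by auto
  have "finite (L \<times> S)"
    using L fin by (auto intro: finite_subset)
  \<comment> \<open>Here \<open>?h\<close> moves \<open>L\<close> to the other factor, so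
    surjectivity comes from comparing cardinalities.\<close>
  moreover have "card (?h ` (S \<times> L)) = card (L \<times> S)"
    using inj by (simp add: card_image card_cartesian_product)
  ultimately have "?h ` (S \<times> L) = L \<times> S"
    using sub by (simp add: card_subset_eq)
  moreover have "?h (x, y) \<in> L \<times> S"
    using xy by simp
  ultimately obtain z where "z \<in> S \<times> L" "?h z = ?h (x, y)"
    by (metis (no_types, lifting) imageE)
  then have "z = (x, y)"
    using inj_onD[OF inj_on_pentagon, of z "(x, y)"] L xy by auto
  then show ?thesis
    using \<open>z \<in> S \<times> L\<close> by simp
qed

lemma right_ideal_minimal:
  assumes x: "x \<in> S" and y: "y \<in> S"
  obtains z where "z \<in> S" "m (m x y) z = x"
proof -
  let ?R = "m (m x y) ` S"
  have R: "?R \<subseteq> S" "\<And>u v. u \<in> ?R \<Longrightarrow> v \<in> S \<Longrightarrow> m u v \<in> ?R"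
    using x y by (auto simp: m_assoc)
  have factor: "u \<in> ?R" if "u \<in> S" "v \<in> S" "m u v \<in> ?R" for u v
    by (rule right_ideal_factor[OF R(1) _ that]) (rule R(2))
  \<comment> \<open>Two uses of \<open>factor\<close> strip off \<open>y\<close>: first
    \<open>m x y\<close>, then \<open>x\<close> lies in \<open>?R\<close>.\<close>
  have "m (m x y) y \<in> ?R"
    using y by blast
  then have "x \<in> ?R"
    using factor m_closed x y by blast
  then show ?thesis
    using that by auto
qed

lemma left_ideal_minimal:
  assumes x: "x \<in> S" and y: "y \<in> S"
  obtains z where "z \<in> S" "m z (m y x) = x"
proof -
  let ?L = "(\<lambda>z. m z (m y x)) ` S"
  have L: "?L \<subseteq> S" "\<And>u v. u \<in> S \<Longrightarrow> v \<in> ?L \<Longrightarrow> m u v \<in> ?L"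
    using x y by (auto simp: m_assoc[symmetric])
  have factor: "v \<in> ?L" if "u \<in> S" "v \<in> S" "m u v \<in> ?L" for u v
    by (rule left_ideal_factor[OF L(1) _ that]) (rule L(2))
  have "m y (m y x) \<in> ?L"
    using y by blast
  then have "x \<in> ?L"
    using factor m_closed x y by blast
  then show ?thesis
    using that by auto
qed

text \<open>Minimality gives \<open>x = x x t = t' x x\<close>; then \<open>t' x = x t\<close>, and
  \<open>(t' x) (x t) = t' x\<close>.\<close>

lemma idempotent_exists:
  assumes "x \<in> S"
  obtains e where "e \<in> S" "m e e = e"
proof -
  obtain t where t: "t \<in> S" "m (m x x) t = x"
    using right_ideal_minimal[OF assms assms] .
  obtain t' where t': "t' \<in> S" "m t' (m x x) = x"
    using left_ideal_minimal[OF assms assms] .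
  have e: "m t' x = m x t"
    using t t' assms by (metis m_assoc m_closed)
  have "m (m t' x) (m x t) = m t' (m (m x x) t)"
    using t t' assms by (simp add: m_assoc)
  then have "m (m t' x) (m t' x) = m t' x"
    by (simp add: e t)
  then show ?thesis
    using that[of "m t' x"] t' assms by simp
qed

section \<open>Injectivity of the maps \<open>th x\<close>\<close>

lemma th_idempotent_fixes_right_ideal:
  assumes p: "p \<in> S" "c p p = p" and w: "w \<in> S" "th p w = w" and z: "z \<in> S"
  shows "th p (m w z) = m w z"
proof -
  obtain z' where z': "z' \<in> S" "m (m w z) z' = w"
    using right_ideal_minimal[OF w(1) z] .
  \<comment> \<open>Chosen so that \<open>ps (m w z) u = p\<close>, which exhibits
    \<open>m w z\<close> as a value of the idempotent map \<open>th p\<close>.\<close>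
  define u where "u = ps z' (m p w)"
  have u: "u \<in> S"
    using p w z' by (simp add: u_def)
  have "ps (m w z) u = ps w (m p w)"
    using ps_action[of "m w z" z' "m p w"] p w z z' by (simp add: u_def)
  also have "\<dots> = p"
    using ps_th_m[of p w] p w by simp
  finally have "th p (c (m w z) u) = m w z"
    using th_ps_c[of u "m w z"] u w z by simp
  then show ?thesis
    using th_action[of p p "c (m w z) u"] p u w z by simp
qed

lemma th_inj_on:
  assumes x: "x \<in> S"
  shows "inj_on (th x) S"
proof -
  interpret dual: finite_bijective_pentagon S c ps m th
    by (rule dual)
  obtain p where p: "p \<in> S" "c p p = p"
    using dual.idempotent_exists[OF x] .
  define w where "w = th p p"
  have w: "w \<in> S" "th p w = w"
    using p th_action[of p p p] by (simp_all add: w_def)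
  define q where "q = m p w"
  have q: "q \<in> S"
    using p w by (simp add: q_def)
  have w_th: "m w y = m w (th q y)" if "y \<in> S" for y
    using th_idempotent_fixes_right_ideal[OF p w that] th_m[of p w y] p w that
    by (simp add: q_def)
  have "inj_on (th q) S"
  proof (rule inj_onI)
    fix y z
    assume yz: "y \<in> S" "z \<in> S" "th q y = th q z"
    then have "m w y = m w z"
      using w_th by metis
    \<comment> \<open>Left multiplication by \<open>p\<close> turns \<open>w\<close> into
      \<open>q\<close>; now both components of the pentagon map agree at \<open>(q, y)\<close> and
      \<open>(q, z)\<close>.\<close>
    then have "m q y = m q z"
      using p w yz by (simp add: q_def m_assoc)
    then show "y = z"
      using c_th_m[of q] q yz by metis
  qed
  moreover have "th q ` S \<subseteq> S"
    using q by auto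
  ultimately have surj: "th q ` S = S"
    using fin endo_inj_surj by blast
  \<comment> \<open>By the action law \<open>th z\<close>, \<open>th x\<close>, \<open>th q\<close>
    compose to \<open>th q\<close>; as \<open>th q\<close> is onto, \<open>th z\<close> is a left
    inverse of \<open>th x\<close>.\<close>
  obtain z where z: "z \<in> S" "c z (c x q) = q"
    using dual.left_ideal_minimal[OF q x] .
  have "th z (th x v) = v" if v: "v \<in> S" for v
  proof -
    obtain y where y: "y \<in> S" "v = th q y"
      using surj v by blast
    then have "th (c z (c x q)) y = v"
      using z by simp
    then show ?thesis
      using th_action[of z "c x q" y] th_action[of x q y] x y z q by simp
  qed
  then show ?thesis
    by (metis inj_onI)
qed

text \<open>An injective idempotent map is the identity.\<close>

lemma th_idempotent:
  assumes "p \<in> S" "c p p = p" "y \<in> S"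
  shows "th p y = y"
  using th_inj_on[of p] th_action[of p p y] assms by (auto dest: inj_onD)

section \<open>Idempotents as right identities, and the resulting groups\<close>

lemma c_idempotent_right_neutral:
  assumes p: "p \<in> S" "c p p = p" and y: "y \<in> S"
  shows "c y p = y"
proof -
  interpret dual: finite_bijective_pentagon S c ps m th
    by (rule dual)
  define E where "E = {q \<in> S. c q q = q}"
  have neutral: "c y (m q y) = y" if "q \<in> E" for q
    using that c_th_m[of q y] th_idempotent[of q y] y by (simp add: E_def)
  have "(\<lambda>q. m q y) ` E \<subseteq> E"
  proof clarify
    fix q
    assume q: "q \<in> E"
    define r where "r = m q y"
    have r: "r \<in> S" "c y r = y"
      using q y neutral by (auto simp: r_def E_def)
    \<comment> \<open>Since \<open>c y r = y\<close>, this reads \<open>r = c z y\<close>, so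
      \<open>c r r = c z (c y r) = r\<close>.\<close>
    obtain z where z: "z \<in> S" "c z (c y r) = r"
      using dual.left_ideal_minimal[OF r(1) y] .
    then have "c r r = r"
      using c_assoc[of z y r] r y by simp
    then show "m q y \<in> E"
      using r by (simp add: E_def r_def)
  qed
  moreover have "inj_on (\<lambda>q. m q y) E"
  proof (rule inj_on_inverseI)
    fix q
    assume "q \<in> E"
    then show "ps y (m q y) = q"
      using ps_th_m[of q y] th_idempotent[of q y] y by (simp add: E_def)
  qed
  moreover have "finite E"
    using fin by (simp add: E_def)
  ultimately have "(\<lambda>q. m q y) ` E = E"
    by (simp add: endo_inj_surj)
  moreover have "p \<in> E"
    using p by (simp add: E_def)
  ultimately show ?thesis
    using neutral by (metis imageE)
qed

lemma group_c:
  assumes e: "e \<in> S" "c e e = e"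
  shows "group \<lparr>carrier = c e ` S, mult = c, one = e\<rparr>"
proof -
  interpret dual: finite_bijective_pentagon S c ps m th
    by (rule dual)
  have right: "c x e = x" if "x \<in> S" for x
    using c_idempotent_right_neutral e that by simp
  have left: "c e x = x" if "x \<in> c e ` S" for x
    using that e c_assoc[symmetric] by auto
  have mem: "c e x \<in> c e ` S" if "x \<in> S" for x
    using that by simp
  have sub: "x \<in> S" if "x \<in> c e ` S" for x
    using that e by auto
  have closed: "c x y \<in> c e ` S" if "x \<in> c e ` S" "y \<in> c e ` S" for x y
    using mem[of "c x y"] left[OF that(1)] c_assoc[of e x y] sub that e by simp
  have e_mem: "e \<in> c e ` S"
    using mem[of e] e by simp
  have right_inv: "\<exists>y \<in> c e ` S. c x y = e" if x: "x \<in> c e ` S" for x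
  proof -
    obtain z where z: "z \<in> S" "c (c e x) z = e"
      using dual.right_ideal_minimal[OF e(1) sub[OF x]] .
    then have "c x (c e z) = e"
      using c_assoc[of x e z] left[OF x] right[OF sub[OF x]] sub[OF x] e(1) by simp
    then show ?thesis
      using mem z by blast
  qed
  have left_inv: "\<exists>y \<in> c e ` S. c y x = e" if x: "x \<in> c e ` S" for x
  proof -
    obtain y where y: "y \<in> c e ` S" "c x y = e"
      using right_inv x by blast
    obtain z where z: "z \<in> c e ` S" "c y z = e"
      using right_inv y by blast
    have "z = x"
      using c_assoc[of x y z] left[OF z(1)] right[OF sub[OF x]] y z
        sub[OF x] sub[OF y(1)] sub[OF z(1)] by simp
    then show ?thesis
      using y z by blast
  qed
  show ?thesis
  proof (rule groupI, unfold partial_object.select_convs monoid.select_convs)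
    fix x y z
    assume "x \<in> c e ` S" "y \<in> c e ` S" "z \<in> c e ` S"
    then show "c (c x y) z = c x (c y z)"
      by (intro c_assoc sub)
  qed (fact closed e_mem left left_inv)+
qed

lemma group_m:
  assumes "e \<in> S" "m e e = e"
  shows "group \<lparr>carrier = m e ` S, mult = m, one = e\<rparr>"
  using finite_bijective_pentagon.group_c[OF dual] assms .

text \<open>Provides the common identity of both groups: \<open>th f\<close> fixes the image of
  \<open>th e\<close>, which is all of \<open>S\<close>, so \<open>th f f = f\<close>.\<close>

lemma th_self_idempotent:
  assumes e: "e \<in> S" "m e e = e"
  defines "f \<equiv> th e e"
  shows "f \<in> S" "m f f = f" "c f f = f"
proof -
  show f: "f \<in> S"
    using e by (simp add: f_def)
  show mf: "m f f = f"
    using th_m[of e e e] e by (simp add: f_def)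
  have "c f e = e"
    using c_th_m[of e e] e by (simp add: f_def)
  then have "th f (th e v) = th e v" if "v \<in> S" for v
    using th_action[of f e v] that f e by simp
  moreover have "th e ` S = S"
    using fin th_inj_on[OF e(1)] e by (intro endo_inj_surj) auto
  ultimately have "th f f = f"
    using f by (metis imageE)
  then show "c f f = f"
    using c_th_m[of f f] f mf by simp
qed

end

section \<open>Component identities from the Pentagon Equation\<close>

lemma finite_bijective_pentagon_of_pe_solution:
  assumes sol: "pe_solution S s" and fin: "finite S" and bij: "pe_bijective S s"
  shows "finite_bijective_pentagon S (pe_dot s) (pe_theta s) (pe_circ S s) (pe_psi S s)"
proof -
  let ?m = "pe_dot s" and ?th = "pe_theta s" and ?c = "pe_circ S s" and ?ps = "pe_psi S s"
  have s_eq: "s (x, y) = (?m x y, ?th x y)" for x y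
    by (simp add: pe_dot_def pe_theta_def)
  have inv_eq: "inv_into (S \<times> S) s (x, y) = (?ps y x, ?c y x)" for x y
    by (simp add: pe_psi_def pe_circ_def)
  have bij': "bij_betw s (S \<times> S) (S \<times> S)"
    using bij by (simp add: pe_bijective_def)
  have m_cl: "?m x y \<in> S" and th_cl: "?th x y \<in> S" if "x \<in> S" "y \<in> S" for x y
    using bij_betwE[OF bij'] that s_eq[of x y] by force+
  have ps_cl: "?ps y x \<in> S" and c_cl: "?c y x \<in> S" if "x \<in> S" "y \<in> S" for x y
    using bij_betwE[OF bij_betw_inv_into[OF bij']] that inv_eq[of x y] by force+
  have m_ps_c: "?m (?ps y x) (?c y x) = x" and th_ps_c: "?th (?ps y x) (?c y x) = y"
    if "x \<in> S" "y \<in> S" for x y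
    using bij_betw_inv_into_right[OF bij', of "(x, y)"] that by (auto simp: inv_eq s_eq)
  have ps_th_m: "?ps (?th x y) (?m x y) = x" and c_th_m: "?c (?th x y) (?m x y) = y"
    if "x \<in> S" "y \<in> S" for x y
    using bij_betw_inv_into_left[OF bij', of "(x, y)"] that by (auto simp: inv_eq s_eq)
  have pentagon: "(pe_23 s \<circ> pe_13 s \<circ> pe_12 s) (x, y, z) = (pe_12 s \<circ> pe_23 s) (x, y, z)"
    if "x \<in> S" "y \<in> S" "z \<in> S" for x y z
    using sol that unfolding pe_solution_def by blast
  have m_assoc: "?m (?m x y) z = ?m x (?m y z)"
    and th_m: "?th x (?m y z) = ?m (?th x y) (?th (?m x y) z)"
    and th_th: "?th (?th x y) (?th (?m x y) z) = ?th y z"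
    if "x \<in> S" "y \<in> S" "z \<in> S" for x y z
    using pentagon[OF that] by (simp_all add: pe_12_def pe_23_def pe_13_def s_eq)
  have dual: "?c (?c r q) p = ?c r (?c q p)
      \<and> ?ps r (?c q p) = ?c (?ps r q) (?ps (?c r q) p)
      \<and> ?ps (?ps r q) (?ps (?c r q) p) = ?ps q p"
    if p: "p \<in> S" and q: "q \<in> S" and r: "r \<in> S" for p q r
  proof -
    \<comment> \<open>Undoing \<open>s\<close> in positions 23, 13 and 12 in turn takes
      \<open>(p, q, r)\<close> back to \<open>(x, y, z)\<close>.\<close>
    define q1 r1 where "q1 = ?ps r q" and "r1 = ?c r q"
    define p1 z where "p1 = ?ps r1 p" and "z = ?c r1 p"
    define x y where "x = ?ps q1 p1" and "y = ?c q1 p1"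
    have q1: "q1 \<in> S" "r1 \<in> S" and p1: "p1 \<in> S" "z \<in> S" and x: "x \<in> S" "y \<in> S"
      using p q r by (simp_all add: q1_def r1_def p1_def z_def x_def y_def ps_cl c_cl)
    have e1: "?m x y = p1" "?th x y = q1"
      using q1 p1 by (simp_all add: x_def y_def m_ps_c th_ps_c)
    have e2: "?m p1 z = p" "?th p1 z = r1"
      using q1 p by (simp_all add: p1_def z_def m_ps_c th_ps_c)
    have e3: "?m q1 r1 = q" "?th q1 r1 = r"
      using q r by (simp_all add: q1_def r1_def m_ps_c th_ps_c)
    \<comment> \<open>The other side of the pentagon passes through \<open>(x, t, r)\<close>;
      inverting it must return the same \<open>x\<close>, \<open>y\<close>,
      \<open>z\<close>.\<close>
    define t where "t = ?m y z"
    have t: "t \<in> S"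
      using x p1 by (simp add: t_def m_cl)
    have "?m x t = p" "?th x t = q" "?th y z = r"
      using m_assoc[of x y z] th_m[of x y z] th_th[of x y z] x p1
      by (simp_all add: e1 e2 e3 t_def)
    then have "?ps q p = x" "?c q p = t" "?ps r t = y" "?c r t = z"
      using ps_th_m[of x t] c_th_m[of x t] ps_th_m[of y z] c_th_m[of y z] x p1 t
      by (simp_all add: t_def)
    then show ?thesis
      by (simp add: q1_def[symmetric] r1_def[symmetric] p1_def[symmetric] z_def[symmetric]
        x_def[symmetric] y_def[symmetric])
  qed
  show ?thesis
  proof
    fix x y z
    assume xyz: "x \<in> S" "y \<in> S" "z \<in> S"
    \<comment> \<open>This is \<open>th_th\<close> at the pair that \<open>s\<close> sends to
      \<open>(y, x)\<close>.\<close>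
    show "?th (?c x y) z = ?th x (?th y z)"
      using th_th[of "?ps x y" "?c x y" z] xyz by (simp add: m_ps_c th_ps_c ps_cl c_cl)
    show "?ps (?m x y) z = ?ps x (?ps y z)"
      using dual[of z "?m x y" "?th x y"] xyz by (simp add: ps_th_m c_th_m m_cl th_cl)
  qed (use fin m_cl th_cl ps_cl c_cl m_assoc th_m dual m_ps_c th_ps_c ps_th_m c_th_m in auto)
qed

section \<open>Comparison of the two extensions\<close>

lemma pe_ext_isomorphic:
  fixes A :: "'a monoid" and G :: "'g monoid" and X :: "'x set"
  assumes closed: "\<And>a b x. a \<in> carrier A \<Longrightarrow> b \<in> carrier A \<Longrightarrow> x \<in> carrier G \<Longrightarrow>
      b \<otimes>\<^bsub>A\<^esub> inv\<^bsub>A\<^esub> (\<delta> x a) \<in> carrier A"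
    and \<phi>: "\<And>a. a \<in> carrier A \<Longrightarrow> bij_betw (\<phi> a) X X"
    and \<rho>: "\<And>a. a \<in> carrier A \<Longrightarrow> bij_betw (\<rho> a) X X"
  shows "pe_isomorphic (pe_ext_carrier X A G) (pe_ext X \<phi> A G \<sigma> \<delta>)
                       (pe_ext_carrier X A G) (pe_ext X \<rho> A G \<sigma> \<delta>)"
proof -
  define f where "f = (\<lambda>(\<alpha>, a, x :: 'g). (inv_into X (\<rho> a) (\<phi> a \<alpha>), a, x))"
  define g where "g = (\<lambda>(\<alpha>, a, x :: 'g). (inv_into X (\<phi> a) (\<rho> a \<alpha>), a, x))"
  have mem: "\<phi> a \<alpha> \<in> X" "\<rho> a \<alpha> \<in> X" "inv_into X (\<phi> a) \<alpha> \<in> X" "inv_into X (\<rho> a) \<alpha> \<in> X"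
    if "a \<in> carrier A" "\<alpha> \<in> X" for a \<alpha>
    using that \<phi> \<rho> bij_betwE bij_betw_inv_into by metis+
  have cancel: "\<phi> a (inv_into X (\<phi> a) \<alpha>) = \<alpha>" "\<rho> a (inv_into X (\<rho> a) \<alpha>) = \<alpha>"
    "inv_into X (\<phi> a) (\<phi> a \<alpha>) = \<alpha>" "inv_into X (\<rho> a) (\<rho> a \<alpha>) = \<alpha>"
    if "a \<in> carrier A" "\<alpha> \<in> X" for a \<alpha>
    using that \<phi>[of a] \<rho>[of a] by (simp_all add: bij_betw_inv_into_right bij_betw_inv_into_left)
  have "bij_betw f (pe_ext_carrier X A G) (pe_ext_carrier X A G)"
    by (rule bij_betw_byWitness[where f' = g])
      (auto simp: f_def g_def pe_ext_carrier_def mem cancel)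
  \<comment> \<open>With \<open>c\<close> the middle entry of the second output triple, both sides
    have \<open>inv_into X (\<rho> c) (\<phi> b \<beta>)\<close> as its
    \<open>X\<close>-entry.\<close>
  moreover have "(map_prod f f \<circ> pe_ext X \<phi> A G \<sigma> \<delta>) p = (pe_ext X \<rho> A G \<sigma> \<delta> \<circ> map_prod f f) p"
    if "p \<in> pe_ext_carrier X A G \<times> pe_ext_carrier X A G" for p
    using that by (auto simp: pe_ext_carrier_def pe_ext_def f_def Let_def mem cancel closed)
  ultimately show ?thesis
    unfolding pe_isomorphic_def by blast
qed

theorem proposition6p3:
  fixes S :: "'a set" and s :: "'a \<times> 'a \<Rightarrow> 'a \<times> 'a" and e0 :: 'a
    and A G :: "'a monoid" and \<sigma> \<delta> :: "'a \<Rightarrow> 'a \<Rightarrow> 'a"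
    and X :: "'x set" and \<phi> \<rho> :: "'a \<Rightarrow> 'x \<Rightarrow> 'x"
  assumes "pe_solution S s" and "finite S" and "pe_bijective S s"
    and "e0 \<in> pe_idempotents S (pe_dot s)"
    and "pe_irretractable S s e0"
    and "A = pe_A S s e0" and "G = pe_G S s e0"
    and "\<sigma> = pe_sigma s e0" and "\<delta> = pe_delta S s e0"
    and "X \<noteq> {}"
    and "\<And>a. a \<in> carrier A \<Longrightarrow> bij_betw (\<phi> a) X X"
    and "\<And>a. a \<in> carrier A \<Longrightarrow> bij_betw (\<rho> a) X X"
  shows "pe_isomorphic (pe_ext_carrier X A G) (pe_ext X \<phi> A G \<sigma> \<delta>)
                       (pe_ext_carrier X A G) (pe_ext X \<rho> A G \<sigma> \<delta>)"
proof (rule pe_ext_isomorphic)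
  interpret finite_bijective_pentagon S "pe_dot s" "pe_theta s" "pe_circ S s" "pe_psi S s"
    using finite_bijective_pentagon_of_pe_solution assms(1-3) .
  have e0: "e0 \<in> S" "pe_dot s e0 e0 = e0"
    using assms(4) by (simp_all add: pe_idempotents_def)
  note one = th_self_idempotent[OF e0, folded pe_one_def]
  interpret A: group A
    unfolding assms(6) pe_A_def using group_c one by blast
  interpret G: group G
    unfolding assms(7) pe_G_def using group_m one by blast
  have carrier_A: "carrier A = pe_circ S s (pe_one s e0) ` S"
    and carrier_G: "carrier G = pe_dot s (pe_one s e0) ` S"
    by (simp_all add: assms(6,7) pe_A_def pe_G_def)
  have A_S: "carrier A \<subseteq> S" and G_S: "carrier G \<subseteq> S"
    using one by (auto simp: carrier_A carrier_G)
  fix a b x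
  assume a: "a \<in> carrier A" and b: "b \<in> carrier A" and x: "x \<in> carrier G"
  \<comment> \<open>The outer product with \<open>pe_one s e0\<close> in \<open>pe_delta\<close>
    lands in \<open>carrier A\<close> once this argument is in \<open>S\<close>.\<close>
  have "pe_psi S s (inv\<^bsub>G\<^esub> x) (inv\<^bsub>A\<^esub> a) \<in> S"
    using ps_closed A.inv_closed[OF a] G.inv_closed[OF x] A_S G_S by blast
  then have "\<delta> x a \<in> carrier A"
    unfolding assms(9) pe_delta_def assms(6,7)[symmetric]
    by (intro A.inv_closed) (simp add: carrier_A)
  then show "b \<otimes>\<^bsub>A\<^esub> inv\<^bsub>A\<^esub> (\<delta> x a) \<in> carrier A"
    using b by simp
qed (use assms(11,12) in auto)

end
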